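(* Let $G$ be a 2T-graph and let $p\ge 1$. Suppose that there are vertex-disjoint circuits $H_0,H_1,\dots,H_p$ of $G$, each of which is a generic component of $G$, such that - each $H_j$, $0\le j\le p$, has external degree $3$; - some vertex $x_0\in V(H_0)$ has external degree $2$ and the third external edge of $H_0$ goes between a vertex $y_0\in V(H_0)\setminus\{x_0\}$ and a vertex $z_1\in V(H_1)$; - some vertex $x_p\in V(H_p)$ has external degree $2$ and the third external edge of $H_p$ goes between a vertex $y_p\in V(H_p)\setminus\{x_p\}$ and a vertex $w\in V(H_{p-1})$, where $w\ne x_0$ if $p=1$; - for each $j\in\{1,\dots,p-1\}$ there is exactly one external edge between $V(H_j)$ and $V(H_{j+1})$. If $G$ has a good ordering $\prec$, then some vertex of $V(H_0)\cup V(H_1)\cup\dots\cup V(H_p)$ is the first or the last vertex according to $\prec$.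
   Context: Graphs and digraphs may contain parallel edges and arcs, respectively, but no loops. $G[X]$ is the subgraph of $G$ induced by $X$. A 2T-graph is a graph whose edge set is the union of two edge-disjoint spanning trees. A graph $G=(V,E)$ is a generic circuit if $|E|=2|V|-2>0$ and $|E(G[X])|\le 2|X|-3$ for every $X\subset V$ with $2\le |X|\le |V|-1$. A circuit of a graph $G$ is an induced subgraph of $G$ which is a generic circuit. For a 2T-graph $G=(V,E)$ let $\mathcal{G}$ be the hypergraph on $V$ whose hyperedges are the vertex sets of the circuits of $G$. Two circuits are connected if their vertex sets lie in the same connected component of $\mathcal{G}$. A generic component of $G$ is either a single vertex lying in no circuit of $G$ or the union of a maximal set of connected circuits. An edge of $G$ is external if it is not contained in any circuit of $G$. The external degree of a vertex $x$ is the number of external edges incident with $x$ in $G$; the external degree of a generic component is the sum of the external degrees of its vertices. An out-branching (respectively in-branching) of a digraph $D$ with root $r$ is a spanning subdigraph whose arcs form a spanning tree of the underlying graph and in which every vertex $v\ne r$ has precisely one entering (respectively leaving) arc and $r$ has no entering (respectively leaving) arc. For a vertex ordering $\prec$ of $G$, $D_\prec$ is the acyclic orientation of $G$ in which each edge $uv$ is oriented from $u$ to $v$ if and only if $u\prec v$. The ordering $\prec$ is good if $D_\prec$ contains an out-branching and an in-branching that are arc-disjoint. *)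

theory Defs
  imports "Graph_Theory.Digraph_Component"
begin

section \<open>Finite loopless multigraphs\<close>

text \<open>
  Edges have an identity of their own, so that parallel edges are distinct elements of \<open>medges\<close>.
\<close>

record ('v, 'e) mgraph =
  mverts :: "'v set"
  medges :: "'e set"
  ends :: "'e \<Rightarrow> 'v set"

locale multigraph =
  fixes G :: "('v, 'e) mgraph" (structure)
  assumes finite_mverts: "finite (mverts G)"
    and finite_medges: "finite (medges G)"
    and ends_subset: "e \<in> medges G \<Longrightarrow> ends G e \<subseteq> mverts G"
    and card_ends: "e \<in> medges G \<Longrightarrow> card (ends G e) = 2"

definition msubgraph :: "('v, 'e) mgraph \<Rightarrow> ('v, 'e) mgraph \<Rightarrow> bool" where
  "msubgraph H G \<longleftrightarrow> multigraph H \<and> multigraph G \<and>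
     mverts H \<subseteq> mverts G \<and> medges H \<subseteq> medges G \<and> ends H = ends G"

definition minduced :: "('v, 'e) mgraph \<Rightarrow> 'v set \<Rightarrow> ('v, 'e) mgraph" where
  "minduced G X = \<lparr>mverts = X, medges = {e \<in> medges G. ends G e \<subseteq> X}, ends = ends G\<rparr>"

definition mconnected :: "('v, 'e) mgraph \<Rightarrow> bool" where
  "mconnected G \<longleftrightarrow> mverts G \<noteq> {} \<and>
     (\<forall>u \<in> mverts G. \<forall>v \<in> mverts G. (u, v) \<in> {(a, b). \<exists>e \<in> medges G. ends G e = {a, b}}\<^sup>*)"

text \<open>
  A cycle is given by its distinct vertices \<open>vs\<close> and its distinct edges \<open>es\<close> in cyclic order;
  two parallel edges form a cycle of length 2.
\<close>

definition mcycle :: "('v, 'e) mgraph \<Rightarrow> 'v list \<Rightarrow> 'e list \<Rightarrow> bool" where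
  "mcycle G vs es \<longleftrightarrow>
     2 \<le> length vs \<and> length es = length vs \<and> distinct vs \<and> distinct es \<and>
     set vs \<subseteq> mverts G \<and> set es \<subseteq> medges G \<and>
     (\<forall>i < length vs. ends G (es ! i) = {vs ! i, vs ! (Suc i mod length vs)})"

definition mtree :: "('v, 'e) mgraph \<Rightarrow> bool" where
  "mtree G \<longleftrightarrow> multigraph G \<and> mconnected G \<and> \<not> (\<exists>vs es. mcycle G vs es)"

definition mspanning_tree :: "('v, 'e) mgraph \<Rightarrow> ('v, 'e) mgraph \<Rightarrow> bool" where
  "mspanning_tree T G \<longleftrightarrow> msubgraph T G \<and> mverts T = mverts G \<and> mtree T"

definition two_tree_graph :: "('v, 'e) mgraph \<Rightarrow> bool" where
  "two_tree_graph G \<longleftrightarrow> multigraph G \<and>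
     (\<exists>T\<^sub>1 T\<^sub>2. mspanning_tree T\<^sub>1 G \<and> mspanning_tree T\<^sub>2 G \<and>
        medges T\<^sub>1 \<inter> medges T\<^sub>2 = {} \<and> medges G = medges T\<^sub>1 \<union> medges T\<^sub>2)"


section \<open>Circuits, generic components and external edges\<close>

definition generic_circuit :: "('v, 'e) mgraph \<Rightarrow> bool" where
  "generic_circuit G \<longleftrightarrow> multigraph G \<and>
     card (medges G) = 2 * card (mverts G) - 2 \<and> card (medges G) > 0 \<and>
     (\<forall>X. X \<subset> mverts G \<and> 2 \<le> card X \<and> card X \<le> card (mverts G) - 1 \<longrightarrow>
        card (medges (minduced G X)) \<le> 2 * card X - 3)"

definition is_circuit :: "('v, 'e) mgraph \<Rightarrow> ('v, 'e) mgraph \<Rightarrow> bool" where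
  "is_circuit G H \<longleftrightarrow> (\<exists>X \<subseteq> mverts G. H = minduced G X) \<and> generic_circuit H"

definition circuit_hyperedges :: "('v, 'e) mgraph \<Rightarrow> 'v set set" where
  "circuit_hyperedges G = {mverts C | C. is_circuit G C}"

text \<open>The vertex sets of the connected components of the hypergraph on \<open>V\<close> with hyperedges \<open>\<H>\<close>.\<close>

definition hypergraph_components :: "'v set \<Rightarrow> 'v set set \<Rightarrow> 'v set set" where
  "hypergraph_components V \<H> =
     V // {(u, v). u \<in> V \<and> v \<in> V \<and> (u, v) \<in> {(a, b). \<exists>h \<in> \<H>. a \<in> h \<and> b \<in> h}\<^sup>*}"

definition circuits_connected :: "('v, 'e) mgraph \<Rightarrow> ('v, 'e) mgraph \<Rightarrow> ('v, 'e) mgraph \<Rightarrow> bool" where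
  "circuits_connected G C C' \<longleftrightarrow>
     (\<exists>K \<in> hypergraph_components (mverts G) (circuit_hyperedges G). mverts C \<subseteq> K \<and> mverts C' \<subseteq> K)"

definition connected_circuit_set :: "('v, 'e) mgraph \<Rightarrow> ('v, 'e) mgraph set \<Rightarrow> bool" where
  "connected_circuit_set G \<C> \<longleftrightarrow> \<C> \<noteq> {} \<and> (\<forall>C \<in> \<C>. is_circuit G C) \<and>
     (\<forall>C \<in> \<C>. \<forall>C' \<in> \<C>. circuits_connected G C C')"

definition generic_component :: "('v, 'e) mgraph \<Rightarrow> ('v, 'e) mgraph \<Rightarrow> bool" where
  "generic_component G H \<longleftrightarrow>
     (\<exists>v \<in> mverts G. (\<forall>C. is_circuit G C \<longrightarrow> v \<notin> mverts C) \<and>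
        H = \<lparr>mverts = {v}, medges = {}, ends = ends G\<rparr>) \<or>
     (\<exists>\<C>. connected_circuit_set G \<C> \<and>
        (\<forall>\<C>'. connected_circuit_set G \<C>' \<and> \<C> \<subseteq> \<C>' \<longrightarrow> \<C>' = \<C>) \<and>
        H = \<lparr>mverts = (\<Union>C \<in> \<C>. mverts C), medges = (\<Union>C \<in> \<C>. medges C), ends = ends G\<rparr>)"

definition external_edges :: "('v, 'e) mgraph \<Rightarrow> 'e set" where
  "external_edges G = {e \<in> medges G. \<forall>C. is_circuit G C \<longrightarrow> e \<notin> medges C}"

definition vertex_external_degree :: "('v, 'e) mgraph \<Rightarrow> 'v \<Rightarrow> nat" where
  "vertex_external_degree G x = card {e \<in> external_edges G. x \<in> ends G e}"

definition component_external_degree :: "('v, 'e) mgraph \<Rightarrow> ('v, 'e) mgraph \<Rightarrow> nat" where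
  "component_external_degree G H = (\<Sum>x \<in> mverts H. vertex_external_degree G x)"

definition external_edges_between :: "('v, 'e) mgraph \<Rightarrow> 'v set \<Rightarrow> 'v set \<Rightarrow> 'e set" where
  "external_edges_between G A B = {e \<in> external_edges G. \<exists>a \<in> A. \<exists>b \<in> B. ends G e = {a, b}}"


section \<open>Branchings and good orderings\<close>

definition underlying :: "('v, 'e) pre_digraph \<Rightarrow> ('v, 'e) mgraph" where
  "underlying D = \<lparr>mverts = verts D, medges = arcs D, ends = (\<lambda>a. {tail D a, head D a})\<rparr>"

text \<open>
  The library predicates \<^const>\<open>tree\<close> and \<^const>\<open>spanning_tree\<close> only forbid directed cycles, hence
  the passage to the underlying multigraph.
\<close>

definition out_branching :: "('v, 'e) pre_digraph \<Rightarrow> ('v, 'e) pre_digraph \<Rightarrow> 'v \<Rightarrow> bool" where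
  "out_branching D B r \<longleftrightarrow> spanning B D \<and> mspanning_tree (underlying B) (underlying D) \<and>
     r \<in> verts D \<and> in_degree B r = 0 \<and> (\<forall>v \<in> verts D. v \<noteq> r \<longrightarrow> in_degree B v = 1)"

definition in_branching :: "('v, 'e) pre_digraph \<Rightarrow> ('v, 'e) pre_digraph \<Rightarrow> 'v \<Rightarrow> bool" where
  "in_branching D B r \<longleftrightarrow> spanning B D \<and> mspanning_tree (underlying B) (underlying D) \<and>
     r \<in> verts D \<and> out_degree B r = 0 \<and> (\<forall>v \<in> verts D. v \<noteq> r \<longrightarrow> out_degree B v = 1)"

text \<open>
  A vertex ordering is a strict linear order \<open>R\<close> on the vertices, with \<open>(u, v) \<in> R\<close> meaning that \<open>u\<close>
  precedes \<open>v\<close>.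
\<close>

definition orientation :: "('v, 'e) mgraph \<Rightarrow> 'v rel \<Rightarrow> ('v, 'e) pre_digraph" where
  "orientation G R = \<lparr>verts = mverts G, arcs = medges G,
     tail = (\<lambda>e. THE u. \<exists>v. ends G e = {u, v} \<and> (u, v) \<in> R),
     head = (\<lambda>e. THE v. \<exists>u. ends G e = {u, v} \<and> (u, v) \<in> R)\<rparr>"

definition good_ordering :: "('v, 'e) mgraph \<Rightarrow> 'v rel \<Rightarrow> bool" where
  "good_ordering G R \<longleftrightarrow> strict_linear_order_on (mverts G) R \<and>
     (\<exists>B\<^sub>1 B\<^sub>2 r\<^sub>1 r\<^sub>2. out_branching (orientation G R) B\<^sub>1 r\<^sub>1 \<and>
        in_branching (orientation G R) B\<^sub>2 r\<^sub>2 \<and> arcs B\<^sub>1 \<inter> arcs B\<^sub>2 = {})"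

definition first_vertex :: "('v, 'e) mgraph \<Rightarrow> 'v rel \<Rightarrow> 'v \<Rightarrow> bool" where
  "first_vertex G R v \<longleftrightarrow> v \<in> mverts G \<and> (\<forall>u \<in> mverts G. u \<noteq> v \<longrightarrow> (v, u) \<in> R)"

definition last_vertex :: "('v, 'e) mgraph \<Rightarrow> 'v rel \<Rightarrow> 'v \<Rightarrow> bool" where
  "last_vertex G R v \<longleftrightarrow> v \<in> mverts G \<and> (\<forall>u \<in> mverts G. u \<noteq> v \<longrightarrow> (u, v) \<in> R)"

end

theory Submission
  imports Defs
begin

text \<open>
  A 2T-graph on \<open>n\<close> vertices has at most \<open>2 (n - 1)\<close> edges, and an out-branching and an in-branching
  have \<open>n - 1\<close> arcs each. So the two branchings of a good ordering partition the whole edge set, and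
  their roots are the first and the last vertex.

  Let \<open>X\<close> be the vertex set of a circuit that contains neither root. The first vertex of \<open>X\<close> is not
  the head of an arc inside \<open>X\<close>, so the out-branching has at most \<open>|X| - 1\<close> arcs inside \<open>X\<close>; dually,
  so has the in-branching. As the circuit has \<open>2 |X| - 2\<close> edges, both bounds are attained. Each vertex
  of \<open>X\<close> is the head of one arc of the out-branching, hence exactly one such arc enters \<open>X\<close>, and it
  does so at the first vertex of \<open>X\<close>. Likewise exactly one arc of the in-branching leaves \<open>X\<close>, at the
  last vertex of \<open>X\<close>. These two arcs are the essential arcs of \<open>X\<close> (lemma \<open>tight_essential\<close>).

  If \<open>X\<close> moreover is a generic component of external degree 3, its external edges are the three
  edges of the cut of \<open>X\<close>, of which exactly one is not essential for \<open>X\<close>. An edge between two disjoint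
  such sets is essential for exactly one of them (lemma \<open>essential_switch\<close>), since an arc entering one
  leaves the other. Finally, if two of the three edges meet at one vertex \<open>x\<close>, then the third edge is
  essential: otherwise both essential arcs would end at \<open>x\<close>, which would be both first and last in \<open>X\<close>
  (lemma \<open>essential_off_degree_two\<close>).

  Suppose now that no root lies in the chain \<open>H\<^sub>0, \<dots>, H\<^sub>p\<close>. The edge from \<open>H\<^sub>0\<close> to \<open>H\<^sub>1\<close> is essential for
  \<open>H\<^sub>0\<close>, so it is the one nonessential edge of \<open>H\<^sub>1\<close>; then the edge from \<open>H\<^sub>1\<close> to \<open>H\<^sub>2\<close> is essential for
  \<open>H\<^sub>1\<close> and nonessential for \<open>H\<^sub>2\<close>, and so on up to \<open>H\<^sub>p\<close>. But the edge from \<open>H\<^sub>p\<close> to its predecessor is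
  essential for \<open>H\<^sub>p\<close> by the hypothesis on \<open>x\<^sub>p\<close>, a contradiction. If \<open>p = 1\<close>, that edge avoids \<open>x\<^sub>0\<close> as
  well, so it would be essential for both circuits.
\<close>


section \<open>Forests have few edges\<close>

definition mpath :: "('v, 'e) mgraph \<Rightarrow> 'v list \<Rightarrow> 'e list \<Rightarrow> bool" where
  "mpath G vs es \<longleftrightarrow> length vs = Suc (length es) \<and> distinct vs \<and>
     set vs \<subseteq> mverts G \<and> set es \<subseteq> medges G \<and>
     (\<forall>i < length es. ends G (es ! i) = {vs ! i, vs ! Suc i})"

lemma mpath_distinct_edges:
  assumes "mpath G vs es"
  shows "distinct es"
proof -
  have False if "i < length es" "j < length es" "i < j" "es ! i = es ! j" for i j
  proof -
    have "{vs ! i, vs ! Suc i} = {vs ! j, vs ! Suc j}"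
      using assms that unfolding mpath_def by metis
    then have "vs ! i = vs ! j \<or> vs ! i = vs ! Suc j" by blast
    then show False
      using assms that nth_eq_iff_index_eq[of vs i j] nth_eq_iff_index_eq[of vs i "Suc j"]
      unfolding mpath_def by auto
  qed
  then show ?thesis
    unfolding distinct_conv_nth by (metis linorder_neqE_nat)
qed

text \<open>
  An edge at the start of a path that is not the first edge of the path lies nowhere on it, because
  the start is met by no other edge of the path. So if its second end is on the path, it closes a
  cycle.
\<close>

lemma mpath_close_cycle:
  assumes path: "mpath G vs es" and e: "e \<in> medges G" "e \<notin> set (take 1 es)"
    and ends: "ends G e = {vs ! 0, vs ! i}" and i: "0 < i" "i < length vs"
  shows "\<exists>ws fs. mcycle G ws fs"
proof -
  have len: "length vs = Suc (length es)" and dv: "distinct vs" using path by (auto simp: mpath_def)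
  have e_new: "e \<notin> set es"
  proof
    assume "e \<in> set es"
    then obtain k where k: "k < length es" "es ! k = e" by (auto simp: in_set_conv_nth)
    then have "k \<noteq> 0" using e(2) by (cases es; cases k) auto
    moreover have "vs ! 0 \<in> {vs ! k, vs ! Suc k}"
      using path k ends unfolding mpath_def by (metis insertI1)
    ultimately show False
      using dv len k nth_eq_iff_index_eq[of vs 0 k] nth_eq_iff_index_eq[of vs 0 "Suc k"] by auto
  qed
  have "mcycle G (take (Suc i) vs) (take i es @ [e])"
    unfolding mcycle_def
  proof (intro conjI allI impI)
    show "distinct (take i es @ [e])"
      using mpath_distinct_edges[OF path] e_new by (auto dest: in_set_takeD)
    show "set (take (Suc i) vs) \<subseteq> mverts G"
      using path by (auto simp: mpath_def dest: in_set_takeD)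
    show "set (take i es @ [e]) \<subseteq> medges G"
      using path e by (auto simp: mpath_def dest: in_set_takeD)
    fix k assume "k < length (take (Suc i) vs)"
    then have k: "k \<le> i" using i by auto
    show "ends G ((take i es @ [e]) ! k) =
       {take (Suc i) vs ! k, take (Suc i) vs ! (Suc k mod length (take (Suc i) vs))}"
    proof (cases "k = i")
      case True
      have "(take i es @ [e]) ! i = e" using i len by (simp add: nth_append)
      moreover have "length (take (Suc i) vs) = Suc i" using i by simp
      ultimately show ?thesis using True ends i by (simp add: insert_commute)
    next
      case False
      then have less: "k < i" "k < length es" using k i len by auto
      then have "(take i es @ [e]) ! k = es ! k" by (simp add: nth_append)
      moreover have "length (take (Suc i) vs) = Suc i" using i by simp
      moreover have "ends G (es ! k) = {vs ! k, vs ! Suc k}" using path less by (simp add: mpath_def)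
      ultimately show ?thesis using less by simp
    qed
  qed (use i len dv in auto)
  then show ?thesis by blast
qed

text \<open>
  The start of a longest path has a second edge, whose other end must be on the path already.
\<close>

lemma min_degree_two_has_cycle:
  assumes "multigraph G" and ne: "mverts G \<noteq> {}"
    and deg: "\<And>v. v \<in> mverts G \<Longrightarrow> 2 \<le> card {e \<in> medges G. v \<in> ends G e}"
  shows "\<exists>vs es. mcycle G vs es"
proof -
  interpret multigraph G by fact
  obtain v0 where v0: "v0 \<in> mverts G" using ne by blast
  have start: "mpath G [v0] []" using v0 by (auto simp: mpath_def)
  have bound: "length es \<le> card (mverts G)" if "mpath G vs es" for vs es
  proof -
    have "length vs = card (set vs)" using that by (simp add: mpath_def distinct_card)
    also have "\<dots> \<le> card (mverts G)"
      using that finite_mverts by (simp add: mpath_def card_mono)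
    finally show ?thesis using that by (simp add: mpath_def)
  qed
  define P where "P n \<longleftrightarrow> (\<exists>vs es. mpath G vs es \<and> length es = n)" for n
  have "\<exists>n. P n \<and> (\<forall>m. P m \<longrightarrow> m \<le> n)"
    by (rule ex_has_greatest_nat[of P 0 id "Suc (card (mverts G))", simplified])
      (use start bound in \<open>auto simp: P_def less_Suc_eq_le\<close>)
  then obtain vs es where path: "mpath G vs es"
    and longest: "\<And>ws fs. mpath G ws fs \<Longrightarrow> length fs \<le> length es"
    unfolding P_def by blast
  let ?v = "vs ! 0"
  let ?D = "{e \<in> medges G. ?v \<in> ends G e}"
  have v: "?v \<in> mverts G" using path by (auto simp: mpath_def)
  have "\<not> ?D \<subseteq> set (take 1 es)"
  proof
    assume "?D \<subseteq> set (take 1 es)"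
    then have "card ?D \<le> card (set (take 1 es))" by (simp add: card_mono)
    also have "\<dots> \<le> 1" using card_length[of "take 1 es"] by auto
    finally show False using deg[OF v] by simp
  qed
  then obtain e where e: "e \<in> medges G" "?v \<in> ends G e" "e \<notin> set (take 1 es)" by blast
  obtain x y where xy: "ends G e = {x, y}" "x \<noteq> y" using card_ends[OF e(1)] by (auto simp: card_2_iff)
  define u where "u = (if ?v = x then y else x)"
  have u: "ends G e = {?v, u}" "u \<noteq> ?v" using e(2) xy by (auto simp: u_def)
  have "u \<in> set vs"
  proof (rule ccontr)
    assume "u \<notin> set vs"
    moreover have "u \<in> mverts G" using ends_subset[OF e(1)] u by blast
    ultimately have "mpath G (u # vs) (e # es)"
      using path e(1) u(1) \<open>u \<notin> set vs\<close>
      by (simp add: mpath_def All_less_Suc2 insert_commute)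
    then show False using longest[of "u # vs" "e # es"] by simp
  qed
  then obtain i where i: "i < length vs" "vs ! i = u" by (auto simp: in_set_conv_nth)
  then have "0 < i" using u(2) by (metis gr0I)
  then show ?thesis using mpath_close_cycle[OF path e(1,3), of i] u(1) i by simp
qed

text \<open>
  A graph without cycles has a vertex of degree at most 1; induction deletes it together with its
  edge.
\<close>

lemma forest_card_edges:
  assumes "multigraph G" "mverts G \<noteq> {}" "\<not> (\<exists>vs es. mcycle G vs es)"
  shows "card (medges G) \<le> card (mverts G) - 1"
  using assms
proof (induction "card (mverts G)" arbitrary: G rule: less_induct)
  case less
  interpret multigraph G by fact
  have "\<not> (\<forall>v \<in> mverts G. 2 \<le> card {e \<in> medges G. v \<in> ends G e})"
    using min_degree_two_has_cycle[OF less.prems(1,2)] less.prems(3) by blast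
  then obtain v where v: "v \<in> mverts G" "card {e \<in> medges G. v \<in> ends G e} < 2"
    by (meson not_le)
  show ?case
  proof (cases "mverts G = {v}")
    case True
    have "medges G = {}"
    proof (rule equals0I)
      fix e assume e: "e \<in> medges G"
      then have "card (ends G e) \<le> card {v}" using ends_subset[OF e] True by (intro card_mono) auto
      then show False using card_ends[OF e] by simp
    qed
    then show ?thesis by simp
  next
    case False
    let ?G = "minduced G (mverts G - {v})"
    have edges: "medges ?G = medges G - {e \<in> medges G. v \<in> ends G e}"
      using ends_subset by (auto simp: minduced_def)
    have "card (medges ?G) \<le> card (mverts ?G) - 1"
    proof (rule less.hyps)
      show "card (mverts ?G) < card (mverts G)"
        using card_Diff1_less[OF finite_mverts v(1)] by (simp add: minduced_def)
      show "multigraph ?G"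
        using finite_mverts finite_medges card_ends by unfold_locales (auto simp: minduced_def)
      show "mverts ?G \<noteq> {}" using False v by (auto simp: minduced_def)
      have "mcycle G vs es" if "mcycle ?G vs es" for vs es
        using that by (auto simp: mcycle_def minduced_def)
      then show "\<not> (\<exists>vs es. mcycle ?G vs es)" using less.prems(3) by blast
    qed
    moreover have "card (medges G) \<le> card (medges ?G) + 1"
      using v(2) finite_medges unfolding edges by (subst card_Diff_subset) auto
    moreover have "card (mverts ?G) = card (mverts G) - 1" "card (mverts G) > 1"
    proof -
      show "card (mverts ?G) = card (mverts G) - 1" using v by (simp add: minduced_def)
      have "card {v} < card (mverts G)" using False v finite_mverts by (intro psubset_card_mono) auto
      then show "card (mverts G) > 1" by simp
    qed
    ultimately show ?thesis by simp
  qed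
qed

lemma two_tree_graph_card_edges:
  assumes "two_tree_graph G"
  shows "card (medges G) \<le> 2 * (card (mverts G) - 1)"
proof -
  obtain T T' where T: "mspanning_tree T G" "mspanning_tree T' G" "medges G = medges T \<union> medges T'"
    using assms unfolding two_tree_graph_def by blast
  have bound: "card (medges S) \<le> card (mverts G) - 1" if S: "mspanning_tree S G" for S
  proof -
    have "multigraph S" "mverts S \<noteq> {}" "\<not> (\<exists>vs es. mcycle S vs es)" "mverts S = mverts G"
      using S unfolding mspanning_tree_def mtree_def mconnected_def by blast+
    then show ?thesis using forest_card_edges[of S] by simp
  qed
  show ?thesis
    using bound[OF T(1)] bound[OF T(2)] card_Un_le[of "medges T" "medges T'"] unfolding T(3) by linarith
qed


section \<open>Arc sets with one arc entering each vertex\<close>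

lemma strict_order_minimum:
  assumes "finite X" "X \<noteq> {}" "trans R" "irrefl R" "total_on X R"
  obtains m where "m \<in> X" "\<And>v. v \<in> X \<Longrightarrow> v \<noteq> m \<Longrightarrow> (m, v) \<in> R"
proof -
  have "\<exists>m \<in> X. \<forall>v \<in> X. v \<noteq> m \<longrightarrow> (m, v) \<in> R"
    using assms(1,2,5)
  proof (induction X rule: finite_ne_induct)
    case (insert x F)
    have "total_on F R" using insert.prems by (auto simp: total_on_def)
    then obtain m where m: "m \<in> F" "\<forall>v \<in> F. v \<noteq> m \<longrightarrow> (m, v) \<in> R" using insert.IH by blast
    then have "(x, m) \<in> R \<or> (m, x) \<in> R"
      using insert.prems insert.hyps unfolding total_on_def by (metis insertCI)
    then show ?case
      using m assms(3) unfolding trans_def by (metis insert_iff)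
  qed simp
  then show ?thesis using that by blast
qed

text \<open>
  All arcs go upwards in \<open>R\<close>, so the minimum of \<open>X\<close> is the head of no arc inside \<open>X\<close>, while every other
  vertex of \<open>X\<close> is the head of at most one. In-branchings are covered by exchanging \<open>src\<close> and \<open>dst\<close> and
  reversing \<open>R\<close>.
\<close>

lemma card_inner_arcs_le:
  assumes "finite X" "X \<noteq> {}" "trans R" "irrefl R" "total_on X R" "finite A"
    and ordered: "\<And>a. a \<in> A \<Longrightarrow> (src a, dst a) \<in> R"
    and one: "\<And>v. v \<in> X \<Longrightarrow> card {a \<in> A. dst a = v} \<le> 1"
  shows "card {a \<in> A. src a \<in> X \<and> dst a \<in> X} \<le> card X - 1"
proof -
  obtain m where m: "m \<in> X" "\<And>v. v \<in> X \<Longrightarrow> v \<noteq> m \<Longrightarrow> (m, v) \<in> R"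
    using strict_order_minimum[OF assms(1-5)] by blast
  have inj: "inj_on dst {a \<in> A. dst a \<in> X}"
  proof (rule inj_onI)
    fix a b assume ab: "a \<in> {a \<in> A. dst a \<in> X}" "b \<in> {a \<in> A. dst a \<in> X}" "dst a = dst b"
    show "a = b"
      using one[of "dst b"] card_le_Suc0_iff_eq[of "{a \<in> A. dst a = dst b}"] ab \<open>finite A\<close> by auto
  qed
  have "dst a \<noteq> m" if "a \<in> A" "src a \<in> X" for a
    using ordered[OF that(1)] m(2)[OF that(2)] assms(3,4) unfolding trans_def irrefl_def by metis
  then have "dst ` {a \<in> A. src a \<in> X \<and> dst a \<in> X} \<subseteq> X - {m}" by auto
  then have "card {a \<in> A. src a \<in> X \<and> dst a \<in> X} \<le> card (X - {m})"
    using \<open>finite X\<close> by (intro card_inj_on_le[of dst] inj_on_subset[OF inj]) auto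
  then show ?thesis using m \<open>finite X\<close> by simp
qed

text \<open>
  Exactly \<open>|X|\<close> arcs have their head in \<open>X\<close>. If \<open>|X| - 1\<close> of them lie inside \<open>X\<close>, then only one enters,
  and this must be the arc whose head is the minimum of \<open>X\<close>.
\<close>

lemma unique_entering_arc:
  assumes "finite X" "X \<noteq> {}" "trans R" "irrefl R" "total_on X R" "finite A"
    and ordered: "\<And>a. a \<in> A \<Longrightarrow> (src a, dst a) \<in> R"
    and one: "\<And>v. v \<in> X \<Longrightarrow> card {a \<in> A. dst a = v} = 1"
    and inner: "card X - 1 \<le> card {a \<in> A. src a \<in> X \<and> dst a \<in> X}"
  obtains a where "{a \<in> A. dst a \<in> X \<and> src a \<notin> X} = {a}"
    "\<And>v. v \<in> X \<Longrightarrow> v \<noteq> dst a \<Longrightarrow> (dst a, v) \<in> R"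
proof -
  obtain m where m: "m \<in> X" "\<And>v. v \<in> X \<Longrightarrow> v \<noteq> m \<Longrightarrow> (m, v) \<in> R"
    using strict_order_minimum[OF assms(1-5)] by blast
  obtain a where a: "{a \<in> A. dst a = m} = {a}" using one[OF m(1)] by (auto simp: card_1_singleton_iff)
  have am: "a \<in> A" "dst a = m" using a by blast+
  have "src a \<notin> X"
    using ordered[of a] m(2)[of "src a"] a assms(3,4) unfolding trans_def irrefl_def
    by (metis (mono_tags, lifting) insertI1 mem_Collect_eq)
  then have a_mem: "a \<in> {a \<in> A. dst a \<in> X \<and> src a \<notin> X}" using am m(1) by simp
  have "card {a \<in> A. dst a \<in> X} = card (\<Union>v \<in> X. {a \<in> A. dst a = v})"
    by (rule arg_cong[of _ _ card]) auto
  also have "\<dots> = (\<Sum>v \<in> X. card {a \<in> A. dst a = v})"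
    using \<open>finite X\<close> \<open>finite A\<close> by (intro card_UN_disjoint) auto
  finally have all: "card {a \<in> A. dst a \<in> X} = card X" using one by simp
  have "card {a \<in> A. dst a \<in> X}
      = card ({a \<in> A. src a \<in> X \<and> dst a \<in> X} \<union> {a \<in> A. dst a \<in> X \<and> src a \<notin> X})"
    by (rule arg_cong[of _ _ card]) auto
  also have "\<dots> = card {a \<in> A. src a \<in> X \<and> dst a \<in> X} + card {a \<in> A. dst a \<in> X \<and> src a \<notin> X}"
    using \<open>finite A\<close> by (intro card_Un_disjoint) auto
  finally have "card {a \<in> A. dst a \<in> X \<and> src a \<notin> X} \<le> 1" using inner all by linarith
  then have "{a \<in> A. dst a \<in> X \<and> src a \<notin> X} = {a}"
    using a_mem card_le_Suc0_iff_eq[of "{a \<in> A. dst a \<in> X \<and> src a \<notin> X}"] \<open>finite A\<close> by auto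
  then show ?thesis using that m(2) unfolding am(2)[symmetric] by blast
qed


section \<open>Cuts and essential arcs\<close>

definition mcut :: "('v, 'e) mgraph \<Rightarrow> 'v set \<Rightarrow> 'e set" where
  "mcut G X = {e \<in> medges G. ends G e \<inter> X \<noteq> {} \<and> \<not> ends G e \<subseteq> X}"

text \<open>
  What is needed of a good ordering: the orientation \<open>src\<close>, \<open>dst\<close> follows \<open>R\<close>, and the edges split into
  the arcs \<open>A\<close> of an out-branching with root \<open>r\<close> and the arcs \<open>B\<close> of an in-branching with root \<open>s\<close>,
  each described by its degree conditions.
\<close>

locale branching_partition = multigraph G for G :: "('v, 'e) mgraph" (structure) +
  fixes R :: "'v rel" and src dst :: "'e \<Rightarrow> 'v" and A B :: "'e set" and r s :: 'v
  assumes order: "trans R" "irrefl R" "total_on (mverts G) R"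
    and ends_eq: "e \<in> medges G \<Longrightarrow> ends G e = {src e, dst e}"
    and ordered: "e \<in> medges G \<Longrightarrow> (src e, dst e) \<in> R"
    and partition: "medges G = A \<union> B" "A \<inter> B = {}"
    and in_A: "v \<in> mverts G \<Longrightarrow> v \<noteq> r \<Longrightarrow> card {a \<in> A. dst a = v} = 1"
    and out_B: "v \<in> mverts G \<Longrightarrow> v \<noteq> s \<Longrightarrow> card {b \<in> B. src b = v} = 1"
begin

definition essential :: "'v set \<Rightarrow> 'e set" where
  "essential X = {a \<in> A. dst a \<in> X \<and> src a \<notin> X} \<union> {b \<in> B. src b \<in> X \<and> dst b \<notin> X}"

text \<open>
  The inner edges of a root-free set number at most \<open>2 |X| - 2\<close>; tight sets attain this bound, as the
  vertex sets of circuits do.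
\<close>

definition tight :: "'v set \<Rightarrow> bool" where
  "tight X \<longleftrightarrow> X \<subseteq> mverts G - {r, s} \<and> 2 \<le> card X \<and> 2 * card X - 2 \<le> card (medges (minduced G X))"

lemma essential_subset_mcut: "essential X \<subseteq> mcut G X"
  using partition ends_eq by (auto simp: essential_def mcut_def)

text \<open>
  Each of \<open>A\<close> and \<open>B\<close> has at most \<open>|X| - 1\<close> arcs inside \<open>X\<close>, so in a tight set both have exactly that
  many. Hence one arc of \<open>A\<close> enters, at the minimum \<open>u\<close> of \<open>X\<close>, and one arc of \<open>B\<close> leaves, at the maximum
  \<open>v\<close>. That \<open>u\<close> and \<open>v\<close> differ is the crucial point for the two ends of the chain.
\<close>

lemma tight_essential:
  assumes "tight X"
  obtains a b u v where "essential X = {a, b}" "a \<noteq> b"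
    "ends G a \<inter> X = {u}" "ends G b \<inter> X = {v}" "u \<noteq> v"
proof -
  have X: "X \<subseteq> mverts G" "r \<notin> X" "s \<notin> X" "2 \<le> card X"
    "2 * card X - 2 \<le> card (medges (minduced G X))"
    using assms by (auto simp: tight_def)
  have fin: "finite X" "X \<noteq> {}" "finite A" "finite B"
    using X finite_mverts finite_medges partition by (auto intro: finite_subset)
  have tot: "total_on X R" "total_on X (R\<inverse>)"
    using order(3) X(1) by (auto simp: total_on_def)
  have ord': "trans (R\<inverse>)" "irrefl (R\<inverse>)" using order by (auto simp: irrefl_def)
  have A: "(src a, dst a) \<in> R" if "a \<in> A" for a using ordered that partition by blast
  have B: "(dst b, src b) \<in> R\<inverse>" if "b \<in> B" for b using ordered that partition by blast
  have inA: "card {a \<in> A. dst a = v} = 1" if "v \<in> X" for v using in_A that X by blast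
  have outB: "card {b \<in> B. src b = v} = 1" if "v \<in> X" for v using out_B that X by blast
  let ?A = "{a \<in> A. src a \<in> X \<and> dst a \<in> X}" and ?B = "{b \<in> B. dst b \<in> X \<and> src b \<in> X}"
  have "medges (minduced G X) = ?A \<union> ?B"
    using partition ends_eq by (auto simp: minduced_def)
  then have "card (medges (minduced G X)) = card ?A + card ?B"
    using fin partition by (simp add: card_Un_disjoint disjoint_iff)
  moreover have "card ?A \<le> card X - 1"
    by (rule card_inner_arcs_le[OF fin(1,2) order(1,2) tot(1) fin(3) A]) (auto simp: inA)
  moreover have "card ?B \<le> card X - 1"
    by (rule card_inner_arcs_le[OF fin(1,2) ord' tot(2) fin(4) B]) (auto simp: outB)
  ultimately have inner: "card X - 1 \<le> card ?A" "card X - 1 \<le> card ?B" using X by auto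
  obtain a where a: "{a \<in> A. dst a \<in> X \<and> src a \<notin> X} = {a}"
    "\<And>v. v \<in> X \<Longrightarrow> v \<noteq> dst a \<Longrightarrow> (dst a, v) \<in> R"
    using unique_entering_arc[OF fin(1,2) order(1,2) tot(1) fin(3) A inA inner(1)] by blast
  obtain b where b: "{b \<in> B. src b \<in> X \<and> dst b \<notin> X} = {b}"
    "\<And>v. v \<in> X \<Longrightarrow> v \<noteq> src b \<Longrightarrow> (src b, v) \<in> R\<inverse>"
    using unique_entering_arc[OF fin(1,2) ord' tot(2) fin(4) B outB inner(2)] by blast
  have am: "a \<in> A" "dst a \<in> X" "src a \<notin> X" and bm: "b \<in> B" "src b \<in> X" "dst b \<notin> X"
    using a(1) b(1) by auto
  have "dst a \<noteq> src b"
  proof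
    assume eq: "dst a = src b"
    have "\<not> X \<subseteq> {dst a}" using X(4) card_mono[of "{dst a}" X] by auto
    then obtain v where "v \<in> X" "v \<noteq> dst a" by blast
    then show False using a(2) b(2) eq order(1,2) unfolding trans_def irrefl_def by (metis converseD)
  qed
  moreover have "ends G a \<inter> X = {dst a}" "ends G b \<inter> X = {src b}"
    using am bm ends_eq partition by auto
  moreover have "essential X = {a, b}" using a(1) b(1) by (auto simp: essential_def)
  moreover have "a \<noteq> b" using am bm partition by blast
  ultimately show ?thesis using that by blast
qed

lemma nonessential_unique:
  assumes "tight X" "card (mcut G X) = 3" "e \<in> mcut G X - essential X" "f \<in> mcut G X - essential X"
  shows "e = f"
proof -
  have "finite (mcut G X)" using assms(2) by (intro card_ge_0_finite) simp
  moreover have "card (essential X) = 2" using tight_essential[OF assms(1)] by (metis card_2_iff)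
  ultimately have "card (mcut G X - essential X) = 1"
    using assms(2) essential_subset_mcut[of X] by (simp add: card_Diff_subset finite_subset)
  then show ?thesis using assms(3,4) by (metis card_1_singletonE singletonD)
qed

text \<open>An arc entering one of two disjoint sets from the other leaves the other one.\<close>

lemma essential_switch:
  assumes "X \<inter> Y = {}" "e \<in> medges G" "ends G e = {x, y}" "x \<in> X" "y \<in> Y"
  shows "e \<in> essential X \<longleftrightarrow> e \<notin> essential Y"
proof -
  have "src e = x \<and> dst e = y \<or> src e = y \<and> dst e = x"
    using assms(3) ends_eq[OF assms(2)] by (simp add: doubleton_eq_iff)
  moreover have "e \<in> A \<longleftrightarrow> e \<notin> B" using assms(2) partition by blast
  moreover have "x \<notin> Y" "y \<notin> X" using assms by blast+
  ultimately show ?thesis using assms(4,5) unfolding essential_def by auto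
qed

text \<open>
  If \<open>e\<close> were not essential, the two essential arcs would be the two cut edges at \<open>x\<close>, although they
  meet \<open>X\<close> in different vertices.
\<close>

lemma essential_off_degree_two:
  assumes "tight X" "card (mcut G X) = 3" "x \<in> X" "card {e \<in> mcut G X. x \<in> ends G e} = 2"
    and e: "e \<in> mcut G X" "x \<notin> ends G e"
  shows "e \<in> essential X"
proof (rule ccontr)
  assume ne: "e \<notin> essential X"
  have fin: "finite (mcut G X)" using assms(2) by (intro card_ge_0_finite) simp
  have at_x: "{e \<in> mcut G X. x \<in> ends G e} = mcut G X - {e}"
    using fin assms(2,4) e by (intro card_subset_eq) auto
  obtain a b u v where ab: "essential X = {a, b}" "ends G a \<inter> X = {u}" "ends G b \<inter> X = {v}" "u \<noteq> v"
    using tight_essential[OF assms(1)] by metis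
  have "{a, b} \<subseteq> {e \<in> mcut G X. x \<in> ends G e}"
    using at_x ne ab(1) essential_subset_mcut[of X] by auto
  then show False using ab assms(3) by auto
qed

end


section \<open>Good orderings partition the edges\<close>

lemma orientation_arc:
  assumes "multigraph G" "strict_linear_order_on (mverts G) R" "e \<in> medges G"
  shows "ends G e = {tail (orientation G R) e, head (orientation G R) e}"
    "(tail (orientation G R) e, head (orientation G R) e) \<in> R"
proof -
  interpret multigraph G by fact
  have R: "trans R" "irrefl R" "total_on (mverts G) R"
    using assms(2) by (auto simp: strict_linear_order_on_def)
  obtain x y where xy: "ends G e = {x, y}" "x \<noteq> y" using card_ends[OF assms(3)] by (auto simp: card_2_iff)
  moreover have "x \<in> mverts G" "y \<in> mverts G" using xy ends_subset[OF assms(3)] by auto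
  ultimately have "(x, y) \<in> R \<or> (y, x) \<in> R" using R(3) unfolding total_on_def by blast
  then obtain u v where uv: "ends G e = {u, v}" "(u, v) \<in> R" using xy by blast
  have asym: "(v, u) \<notin> R" using uv R unfolding trans_def irrefl_def by blast
  have "tail (orientation G R) e = u"
    unfolding orientation_def pre_digraph.simps
    by (rule the_equality) (use uv asym in \<open>auto simp: doubleton_eq_iff\<close>)
  moreover have "head (orientation G R) e = v"
    unfolding orientation_def pre_digraph.simps
    by (rule the_equality) (use uv asym in \<open>auto simp: doubleton_eq_iff\<close>)
  ultimately show "ends G e = {tail (orientation G R) e, head (orientation G R) e}"
    "(tail (orientation G R) e, head (orientation G R) e) \<in> R" using uv by auto
qed

lemma card_arcs_single_degree:
  assumes "finite V" "finite A" "r \<in> V" "\<And>a. a \<in> A \<Longrightarrow> f a \<in> V"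
    "card {a \<in> A. f a = r} = 0" "\<And>v. v \<in> V \<Longrightarrow> v \<noteq> r \<Longrightarrow> card {a \<in> A. f a = v} = 1"
  shows "card A = card V - 1"
proof -
  have "card A = card (\<Union>v \<in> V. {a \<in> A. f a = v})"
    by (rule arg_cong[of _ _ card]) (use assms(4) in auto)
  also have "\<dots> = (\<Sum>v \<in> V. card {a \<in> A. f a = v})"
    using assms(1,2) by (intro card_UN_disjoint) auto
  also have "\<dots> = (\<Sum>v \<in> V - {r}. card {a \<in> A. f a = v})"
    using assms by (simp add: sum.remove)
  also have "\<dots> = card V - 1" using assms by simp
  finally show ?thesis .
qed

text \<open>
  The minimum is the head of no arc, so it can only be the exceptional vertex \<open>r\<close>.
\<close>

lemma root_is_extreme:
  assumes "finite V" "V \<noteq> {}" "trans R" "irrefl R" "total_on V R"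
    and ordered: "\<And>a. a \<in> A \<Longrightarrow> (src a, dst a) \<in> R \<and> src a \<in> V"
    and one: "\<And>v. v \<in> V \<Longrightarrow> v \<noteq> r \<Longrightarrow> card {a \<in> A. dst a = v} = 1"
  shows "r \<in> V \<and> (\<forall>v \<in> V. v \<noteq> r \<longrightarrow> (r, v) \<in> R)"
proof -
  obtain m where m: "m \<in> V" "\<And>v. v \<in> V \<Longrightarrow> v \<noteq> m \<Longrightarrow> (m, v) \<in> R"
    using strict_order_minimum[OF assms(1-5)] by blast
  have "dst a \<noteq> m" if "a \<in> A" for a
    using ordered[OF that] m(2)[of "src a"] assms(3,4) unfolding trans_def irrefl_def by metis
  then have none: "{a \<in> A. dst a = m} = {}" by blast
  have "card {a \<in> A. dst a = m} \<noteq> 1" unfolding none by simp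
  then have "m = r" using one[OF m(1)] by blast
  then show ?thesis using m by blast
qed

text \<open>
  The branchings have \<open>n - 1\<close> arcs each by their degree conditions and are arc-disjoint, so together
  they have as many arcs as the 2T-graph can have edges.
\<close>

lemma good_ordering_partition:
  assumes two: "two_tree_graph G" and good: "good_ordering G R"
  obtains A B r s where "branching_partition G R (tail (orientation G R)) (head (orientation G R)) A B r s"
    "first_vertex G R r" "last_vertex G R s"
proof -
  interpret multigraph G using two by (simp add: two_tree_graph_def)
  let ?D = "orientation G R"
  obtain S T r s where lin: "strict_linear_order_on (mverts G) R"
    and S: "out_branching ?D S r" and T: "in_branching ?D T s" and disj: "arcs S \<inter> arcs T = {}"
    using good unfolding good_ordering_def by blast
  have R: "trans R" "irrefl R" "total_on (mverts G) R"
    using lin by (auto simp: strict_linear_order_on_def)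
  have D: "verts ?D = mverts G" "arcs ?D = medges G" by (auto simp: orientation_def)
  have Ssub: "arcs S \<subseteq> medges G" "head S = head ?D" and Tsub: "arcs T \<subseteq> medges G" "tail T = tail ?D"
    using S T D unfolding out_branching_def in_branching_def spanning_def subgraph_def compatible_def by auto
  have r: "r \<in> mverts G" "card {a \<in> arcs S. head ?D a = r} = 0"
    and in1: "\<And>v. v \<in> mverts G \<Longrightarrow> v \<noteq> r \<Longrightarrow> card {a \<in> arcs S. head ?D a = v} = 1"
    using S D Ssub by (auto simp: out_branching_def in_degree_def in_arcs_def)
  have s: "s \<in> mverts G" "card {a \<in> arcs T. tail ?D a = s} = 0"
    and out1: "\<And>v. v \<in> mverts G \<Longrightarrow> v \<noteq> s \<Longrightarrow> card {a \<in> arcs T. tail ?D a = v} = 1"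
    using T D Tsub by (auto simp: in_branching_def out_degree_def out_arcs_def)
  note arc = orientation_arc[OF multigraph_axioms lin]
  have arc_in: "tail ?D e \<in> mverts G" "head ?D e \<in> mverts G" if "e \<in> medges G" for e
    using arc(1)[OF that] ends_subset[OF that] by auto
  have fin: "finite (arcs S)" "finite (arcs T)" using Ssub Tsub finite_medges by (auto intro: finite_subset)
  have "card (arcs S) = card (mverts G) - 1"
    by (rule card_arcs_single_degree[OF finite_mverts fin(1) r(1) _ r(2) in1]) (use arc_in Ssub in auto)
  moreover have "card (arcs T) = card (mverts G) - 1"
    by (rule card_arcs_single_degree[OF finite_mverts fin(2) s(1) _ s(2) out1]) (use arc_in Tsub in auto)
  ultimately have "card (medges G) \<le> card (arcs S \<union> arcs T)"
    using two_tree_graph_card_edges[OF two] card_Un_disjoint[OF fin disj] by simp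
  then have all: "medges G = arcs S \<union> arcs T"
    using Ssub Tsub finite_medges by (metis Un_least card_seteq)
  have "branching_partition G R (tail ?D) (head ?D) (arcs S) (arcs T) r s"
    by unfold_locales (use R arc all disj in1 out1 in auto)
  moreover have "first_vertex G R r"
  proof -
    have "r \<in> mverts G \<and> (\<forall>v \<in> mverts G. v \<noteq> r \<longrightarrow> (r, v) \<in> R)"
      by (rule root_is_extreme[OF finite_mverts _ R _ in1, where src = "tail ?D"])
        (use r arc(2) arc_in Ssub in auto)
    then show ?thesis by (auto simp: first_vertex_def)
  qed
  moreover have "last_vertex G R s"
  proof -
    have R': "trans (R\<inverse>)" "irrefl (R\<inverse>)" "total_on (mverts G) (R\<inverse>)"
      using R by (auto simp: irrefl_def total_on_def)
    have "s \<in> mverts G \<and> (\<forall>v \<in> mverts G. v \<noteq> s \<longrightarrow> (s, v) \<in> R\<inverse>)"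
      by (rule root_is_extreme[OF finite_mverts _ R' _ out1, where src = "head ?D"])
        (use s arc(2) arc_in Tsub in auto)
    then show ?thesis by (auto simp: last_vertex_def)
  qed
  ultimately show ?thesis using that by blast
qed


section \<open>External edges of a circuit that is a generic component\<close>

lemma is_circuitD:
  assumes "is_circuit G C"
  shows "mverts C \<subseteq> mverts G" "C = minduced G (mverts C)" "2 \<le> card (mverts C)"
    "card (medges C) = 2 * card (mverts C) - 2"
    "medges C = {e \<in> medges G. ends G e \<subseteq> mverts C}"
proof -
  obtain X where X: "X \<subseteq> mverts G" "C = minduced G X"
    and C: "card (medges C) = 2 * card (mverts C) - 2" "card (medges C) > 0"
    using assms unfolding is_circuit_def generic_circuit_def by blast
  have "mverts C = X" using X(2) by (simp add: minduced_def)
  then show "mverts C \<subseteq> mverts G" "C = minduced G (mverts C)" using X by simp_all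
  show "medges C = {e \<in> medges G. ends G e \<subseteq> mverts C}"
    unfolding \<open>mverts C = X\<close> using X(2) by (simp add: minduced_def)
  show "card (medges C) = 2 * card (mverts C) - 2" by (rule C(1))
  show "2 \<le> card (mverts C)" using C by linarith
qed

text \<open>
  A circuit \<open>C\<close> that shares the vertex \<open>x\<close> with the component lies in the hypergraph component of \<open>x\<close>,
  as do all circuits forming \<open>H\<close>. Adding \<open>C\<close> to them keeps them connected, so \<open>C\<close> is one of them by
  maximality.
\<close>

lemma generic_component_absorbs:
  assumes circ: "is_circuit G H" and comp: "generic_component G H"
    and C: "is_circuit G C" and meet: "x \<in> mverts C" "x \<in> mverts H"
  shows "mverts C \<subseteq> mverts H"
proof -
  have "card (medges H) \<noteq> 0"
    using is_circuitD(3,4)[OF circ] by linarith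
  then have "medges H \<noteq> {}" by (metis card.empty)
  then have "H \<noteq> \<lparr>mverts = {v}, medges = {}, ends = ends G\<rparr>" for v by auto
  then obtain \<C> where conn: "connected_circuit_set G \<C>"
    and max: "\<forall>\<C>'. connected_circuit_set G \<C>' \<and> \<C> \<subseteq> \<C>' \<longrightarrow> \<C>' = \<C>"
    and H: "H = \<lparr>mverts = (\<Union>C \<in> \<C>. mverts C), medges = (\<Union>C \<in> \<C>. medges C), ends = ends G\<rparr>"
    using comp unfolding generic_component_def by blast
  have maximal: "\<C>' = \<C>" if "connected_circuit_set G \<C>'" "\<C> \<subseteq> \<C>'" for \<C>'
    using max that by blast
  have verts: "mverts H = (\<Union>C \<in> \<C>. mverts C)" using H by simp
  let ?S = "{(a, b). \<exists>h \<in> circuit_hyperedges G. a \<in> h \<and> b \<in> h}"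
  define r where "r = {(u, v). u \<in> mverts G \<and> v \<in> mverts G \<and> (u, v) \<in> ?S\<^sup>*}"
  have "sym (?S\<^sup>*)" by (rule sym_rtrancl) (auto simp: sym_def)
  then have equiv: "equiv (mverts G) r"
    by (intro equivI) (auto simp: r_def refl_on_def sym_def trans_def intro: rtrancl_trans)
  let ?K = "r `` {x}"
  have x: "x \<in> mverts G" using is_circuitD(1)[OF C] meet by blast
  then have K: "?K \<in> hypergraph_components (mverts G) (circuit_hyperedges G)"
    unfolding hypergraph_components_def r_def by (intro quotientI) simp
  have CK: "mverts C \<subseteq> ?K"
  proof
    fix y assume "y \<in> mverts C"
    then have "(x, y) \<in> ?S" using C meet(1) by (auto simp: circuit_hyperedges_def)
    then show "y \<in> ?K" using \<open>y \<in> mverts C\<close> is_circuitD(1)[OF C] x by (auto simp: r_def)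
  qed
  obtain C0 where C0: "C0 \<in> \<C>" "x \<in> mverts C0" using meet(2) verts by blast
  have C'K: "mverts C' \<subseteq> ?K" if "C' \<in> \<C>" for C'
  proof -
    have "circuits_connected G C0 C'"
      using conn C0(1) that by (simp add: connected_circuit_set_def)
    then obtain L where L: "L \<in> mverts G // r" "mverts C0 \<subseteq> L" "mverts C' \<subseteq> L"
      unfolding circuits_connected_def hypergraph_components_def r_def[symmetric] by blast
    from L(1) obtain z where z: "L = r `` {z}" by (rule quotientE)
    then have "(z, x) \<in> r" using L(2) C0(2) by blast
    then have "L = ?K" unfolding z by (rule equiv_class_eq[OF equiv])
    then show ?thesis using L by blast
  qed
  have in_K: "mverts C' \<subseteq> ?K" if "C' \<in> insert C \<C>" for C' using that CK C'K by auto
  have "circuits_connected G C' C''" if "C' \<in> insert C \<C>" "C'' \<in> insert C \<C>" for C' C''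
    unfolding circuits_connected_def using K in_K[OF that(1)] in_K[OF that(2)] by (intro bexI[of _ ?K]) auto
  moreover have "is_circuit G C'" if "C' \<in> insert C \<C>" for C'
    using that conn C by (auto simp: connected_circuit_set_def)
  ultimately have "connected_circuit_set G (insert C \<C>)"
    unfolding connected_circuit_set_def by simp
  then have "insert C \<C> = \<C>" by (rule maximal) blast
  then have "C \<in> \<C>" by blast
  then show ?thesis using verts by blast
qed

text \<open>
  Edges inside \<open>H\<close> belong to the circuit \<open>H\<close>; an edge leaving \<open>H\<close> belongs to no circuit, because a
  circuit meeting \<open>H\<close> stays inside \<open>H\<close>.
\<close>

lemma external_incident_iff_cut:
  assumes "is_circuit G H" "generic_component G H" "x \<in> mverts H"
  shows "{e \<in> external_edges G. x \<in> ends G e} = {e \<in> mcut G (mverts H). x \<in> ends G e}"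
proof (intro set_eqI iffI)
  fix e assume "e \<in> {e \<in> external_edges G. x \<in> ends G e}"
  then have e: "e \<in> medges G" "x \<in> ends G e" "e \<notin> medges H"
    using assms(1) unfolding external_edges_def by blast+
  then have "\<not> ends G e \<subseteq> mverts H" using is_circuitD(5)[OF assms(1)] by blast
  then show "e \<in> {e \<in> mcut G (mverts H). x \<in> ends G e}" using e assms(3) by (auto simp: mcut_def)
next
  fix e assume "e \<in> {e \<in> mcut G (mverts H). x \<in> ends G e}"
  then have e: "e \<in> medges G" "x \<in> ends G e" "\<not> ends G e \<subseteq> mverts H" by (auto simp: mcut_def)
  have "e \<notin> medges C" if C: "is_circuit G C" for C
  proof
    assume "e \<in> medges C"
    then have "ends G e \<subseteq> mverts C" using is_circuitD(5)[OF C] by blast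
    then show False using generic_component_absorbs[OF assms(1,2) C _ assms(3)] e by blast
  qed
  then show "e \<in> {e \<in> external_edges G. x \<in> ends G e}" using e(1,2) unfolding external_edges_def by blast
qed

text \<open>The degree sum counts no cut edge twice, since each has only one end in \<open>H\<close>.\<close>

lemma component_external_degree_eq_card_mcut:
  assumes "multigraph G" "is_circuit G H" "generic_component G H"
  shows "component_external_degree G H = card (mcut G (mverts H))"
proof -
  interpret multigraph G by fact
  let ?X = "mverts H"
  have fin: "finite ?X" using is_circuitD(1)[OF assms(2)] finite_mverts by (rule finite_subset)
  have fin': "finite (mcut G ?X)" using finite_medges by (simp add: mcut_def)
  have one_end: "x = y" if "e \<in> mcut G ?X" "x \<in> ?X" "y \<in> ?X" "x \<in> ends G e" "y \<in> ends G e" for e x y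
    using that card_ends[of e] by (auto simp: mcut_def card_2_iff)
  have "component_external_degree G H = (\<Sum>x \<in> ?X. card {e \<in> mcut G ?X. x \<in> ends G e})"
    unfolding component_external_degree_def vertex_external_degree_def
    using external_incident_iff_cut[OF assms(2,3)] by simp
  also have "\<dots> = card (\<Union>x \<in> ?X. {e \<in> mcut G ?X. x \<in> ends G e})"
    using fin fin' one_end by (intro card_UN_disjoint[symmetric]) auto
  also have "(\<Union>x \<in> ?X. {e \<in> mcut G ?X. x \<in> ends G e}) = mcut G ?X" by (auto simp: mcut_def)
  finally show ?thesis .
qed


section \<open>Chains of circuits\<close>

theorem theorem5p7:
  fixes G :: "('v, 'e) mgraph" and H :: "nat \<Rightarrow> ('v, 'e) mgraph" and p :: nat
    and x\<^sub>0 y\<^sub>0 z\<^sub>1 x\<^sub>p y\<^sub>p w :: 'v and R :: "'v rel"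
  assumes "two_tree_graph G"
    and "1 \<le> p"
    and "\<And>j. j \<le> p \<Longrightarrow> is_circuit G (H j)"
    and "\<And>j. j \<le> p \<Longrightarrow> generic_component G (H j)"
    and "\<And>i j. i \<le> p \<Longrightarrow> j \<le> p \<Longrightarrow> i \<noteq> j \<Longrightarrow> mverts (H i) \<inter> mverts (H j) = {}"
    and "\<And>j. j \<le> p \<Longrightarrow> component_external_degree G (H j) = 3"
    and "x\<^sub>0 \<in> mverts (H 0)" and "vertex_external_degree G x\<^sub>0 = 2"
    and "y\<^sub>0 \<in> mverts (H 0) - {x\<^sub>0}" and "z\<^sub>1 \<in> mverts (H 1)"
    and "\<exists>e \<in> external_edges G. ends G e = {y\<^sub>0, z\<^sub>1}"
    and "x\<^sub>p \<in> mverts (H p)" and "vertex_external_degree G x\<^sub>p = 2"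
    and "y\<^sub>p \<in> mverts (H p) - {x\<^sub>p}" and "w \<in> mverts (H (p - 1))"
    and "p = 1 \<Longrightarrow> w \<noteq> x\<^sub>0"
    and "\<exists>e \<in> external_edges G. ends G e = {y\<^sub>p, w}"
    and "\<And>j. j \<in> {1..p - 1} \<Longrightarrow>
           card (external_edges_between G (mverts (H j)) (mverts (H (j + 1)))) = 1"
    and "good_ordering G R"
  shows "\<exists>v \<in> (\<Union>j \<le> p. mverts (H j)). first_vertex G R v \<or> last_vertex G R v"
proof (rule ccontr)
  assume no_extreme: "\<not> ?thesis"
  obtain A B r s where
    part: "branching_partition G R (tail (orientation G R)) (head (orientation G R)) A B r s"
    and rs: "first_vertex G R r" "last_vertex G R s"
    using good_ordering_partition[OF assms(1,19)] by blast
  interpret branching_partition G R "tail (orientation G R)" "head (orientation G R)" A B r s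
    by (rule part)
  let ?X = "\<lambda>j. mverts (H j)"
  have tight: "tight (?X j)" if "j \<le> p" for j
  proof -
    note circ = is_circuitD[OF assms(3)[OF that]]
    have "r \<notin> ?X j" "s \<notin> ?X j" using no_extreme rs that by auto
    then show ?thesis using circ by (auto simp: tight_def)
  qed
  have card_mcut: "card (mcut G (?X j)) = 3" if "j \<le> p" for j
    using component_external_degree_eq_card_mcut[OF multigraph_axioms assms(3,4)[OF that]] assms(6)[OF that]
    by simp
  have edge_in_cut: "e \<in> medges G" "e \<in> mcut G (?X i)" "e \<in> mcut G (?X j)"
    if "e \<in> external_edges G" "ends G e = {x, y}" "x \<in> ?X i" "y \<in> ?X j" "i \<le> p" "j \<le> p" "i \<noteq> j"
    for e x y i j
    using that assms(5)[OF that(5-7)] by (auto simp: external_edges_def mcut_def)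
  have switch: "e \<in> essential (?X i) \<longleftrightarrow> e \<notin> essential (?X j)"
    if "e \<in> external_edges G" "ends G e = {x, y}" "x \<in> ?X i" "y \<in> ?X j" "i \<le> p" "j \<le> p" "i \<noteq> j"
    for e x y i j
    using essential_switch[OF assms(5)[OF that(5-7)] edge_in_cut(1)[OF that] that(2-4)] .
  have off_x: "e \<in> essential (?X j)"
    if "j \<le> p" "x \<in> ?X j" "vertex_external_degree G x = 2" "e \<in> mcut G (?X j)" "x \<notin> ends G e" for e x j
  proof (rule essential_off_degree_two[OF tight[OF that(1)] card_mcut[OF that(1)] that(2) _ that(4,5)])
    show "card {e \<in> mcut G (?X j). x \<in> ends G e} = 2"
      using that(3) external_incident_iff_cut[OF assms(3,4)[OF that(1)] that(2)]
      by (simp add: vertex_external_degree_def)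
  qed
  \<comment> \<open>The chain is closed at its far end by \<open>f\<close>, which is essential for \<open>H p\<close>, not for \<open>H (p - 1)\<close>.\<close>
  obtain f where f: "f \<in> external_edges G" "ends G f = {w, y\<^sub>p}"
    using assms(17) by (metis insert_commute)
  have yp: "y\<^sub>p \<in> ?X p" "y\<^sub>p \<noteq> x\<^sub>p" using assms(14) by auto
  have p1: "p - 1 \<le> p" "p - 1 \<noteq> p" using assms(2) by auto
  note f_cut = edge_in_cut[OF f assms(15) yp(1) p1(1) order_refl p1(2)]
  have "x\<^sub>p \<noteq> w" using assms(5)[OF p1(1) order_refl p1(2)] assms(12,15) by blast
  then have "f \<in> essential (?X p)"
    using off_x[OF order_refl assms(12,13) f_cut(3)] f(2) yp by auto
  then have f_free: "f \<in> mcut G (?X (p - 1)) - essential (?X (p - 1))"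
    using switch[OF f assms(15) yp(1) p1(1) order_refl p1(2)] f_cut by blast
  \<comment> \<open>The chain stops before \<open>H p\<close>: its last link is \<open>f\<close>, the edge known to avoid \<open>x\<^sub>p\<close>.\<close>
  have chain: "\<exists>e x y. e \<in> external_edges G \<and> ends G e = {x, y} \<and> x \<in> ?X j \<and> y \<in> ?X (Suc j) \<and>
      e \<notin> essential (?X (Suc j))" if "Suc j < p" for j
    using that
  proof (induction j)
    case 0
    obtain e where e: "e \<in> external_edges G" "ends G e = {y\<^sub>0, z\<^sub>1}" using assms(11) by blast
    have y0: "y\<^sub>0 \<in> ?X 0" "y\<^sub>0 \<noteq> x\<^sub>0" and z1: "z\<^sub>1 \<in> ?X (Suc 0)" using assms(9,10) by auto
    have p: "0 \<le> p" "Suc 0 \<le> p" "0 \<noteq> Suc 0" using assms(2) by auto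
    have "x\<^sub>0 \<noteq> z\<^sub>1" using assms(5)[OF p] assms(7) z1 by blast
    then have "e \<in> essential (?X 0)"
      using off_x[OF p(1) assms(7,8) edge_in_cut(2)[OF e y0(1) z1 p]] e(2) y0 by auto
    then show ?case using switch[OF e y0(1) z1 p] e y0 z1 by blast
  next
    case (Suc j)
    then obtain e x y where e: "e \<in> external_edges G" "ends G e = {x, y}" "x \<in> ?X j"
      "y \<in> ?X (Suc j)" "e \<notin> essential (?X (Suc j))" by auto
    have "Suc j \<in> {1..p - 1}" using Suc.prems by auto
    then obtain g where "g \<in> external_edges_between G (?X (Suc j)) (?X (Suc j + 1))"
      using assms(18) by (metis card_1_singletonE singletonI)
    then obtain a b where g: "g \<in> external_edges G" "ends G g = {a, b}" "a \<in> ?X (Suc j)" "b \<in> ?X (Suc (Suc j))"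
      by (auto simp: external_edges_between_def)
    have j: "j \<le> p" "Suc j \<le> p" "Suc (Suc j) \<le> p" "j \<noteq> Suc j" "Suc j \<noteq> Suc (Suc j)" "j \<noteq> Suc (Suc j)"
      using Suc.prems by auto
    have "x \<noteq> a" "x \<noteq> b"
      using e(3) g(3,4) assms(5)[OF j(1,2,4)] assms(5)[OF j(1,3,6)] by blast+
    then have "e \<noteq> g" using e(2) g(2) by auto
    moreover have "e \<in> mcut G (?X (Suc j)) - essential (?X (Suc j))"
      using edge_in_cut(3)[OF e(1-4) j(1,2,4)] e(5) by simp
    ultimately have "g \<in> essential (?X (Suc j))"
      using nonessential_unique[OF tight[OF j(2)] card_mcut[OF j(2)], of e g]
        edge_in_cut(2)[OF g j(2,3,5)] by auto
    then show ?case using switch[OF g j(2,3,5)] g by blast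
  qed
  show False
  proof (cases "p = 1")
    case True
    \<comment> \<open>With only two circuits, \<open>f\<close> avoids both \<open>x\<^sub>0\<close> and \<open>x\<^sub>p\<close>, hence is essential at both of its ends.\<close>
    then have "x\<^sub>0 \<noteq> w" "x\<^sub>0 \<noteq> y\<^sub>p" using assms(5)[of 0 p] assms(7,16) yp by auto
    then have "f \<in> essential (?X 0)"
      using off_x[of 0 x\<^sub>0 f] assms(7,8) f_cut(2) f(2) True by auto
    then show False using f_free True by simp
  next
    case False
    then have "p = Suc (Suc (p - 2))" using assms(2) by simp
    then obtain j where j: "p = Suc (Suc j)" by blast
    obtain e x y where e: "e \<in> external_edges G" "ends G e = {x, y}" "x \<in> ?X j"
      "y \<in> ?X (Suc j)" "e \<notin> essential (?X (Suc j))" using chain[of j] j by auto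
    \<comment> \<open>Both \<open>e\<close> and \<open>f\<close> are nonessential for \<open>H (p - 1)\<close>, but only \<open>e\<close> has an end in \<open>H (p - 2)\<close>.\<close>
    have "e \<in> mcut G (?X (Suc j)) - essential (?X (Suc j))"
      using edge_in_cut(3)[OF e(1-4)] e(5) j by simp
    then have "e = f"
      using nonessential_unique[OF tight[of "Suc j"] card_mcut[of "Suc j"], of e f] f_free j by simp
    moreover have "x \<noteq> w" "x \<noteq> y\<^sub>p"
      using e(3) assms(5)[of j p] assms(5)[of j "p - 1"] assms(15) yp(1) j by auto
    ultimately show False using e(2) f(2) by auto
  qed
qed

end
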